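(* In the discrete setting described in the context, for $(R^{**},V^* )\in\mathbb{R}^n\times\mathbb{R}^n$ given by $$(V^* )^T=-\Big((L(Y))^TM_{ED}+\frac2\epsilon Y^TN(Z)\Big)K^{-1}B^1(G,\epsilon),$$ $$(R^{**})^T=-\Big((L(Y))^TM_{ED}+\frac2\epsilon Y^TN(Z)\Big)K^{-1}C^1(G,\epsilon,U)-\frac1\epsilon\Big((\widetilde\Lambda_1^1)^TB^2(G,Z)+(\widetilde\Lambda_1^2)^TB^3(G,Z)\Big)$$ $$-\frac1\epsilon\Big(-(\widetilde\Lambda_2^1)^T\Pi_h^2+(\widetilde\Lambda_2^2)^T\Pi_h^1\Big)-\frac1\epsilon\Big((\widetilde\Lambda_3^1)^TB^2(G,Z)+(\widetilde\Lambda_3^2)^TB^3(G,Z)\Big),$$ we obtain a descent direction for $J$ at $(G,U)$.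
   Context: $E\subset\subset D\subset\mathbb{R}^2$ are polygonal bounded domains, $\epsilon>0$, $f$ is a given load on $D$, $j$ is the cost integrand and $\partial_2j$ its derivative in the second argument; the subscript $+$ denotes the positive part and $(\cdot)_+^2$ its square. $\mathcal{T}_h$ is a triangulation of $D$ into closed triangles with vertices $A_i$, $i\in I=\{1,\dots,n\}$, each triangle being contained in $\overline E$ or in $\overline{D\setminus E}$. $\mathbb{W}_h$ is the space of continuous functions on $\overline D$ that are affine on each triangle, with hat-function basis $\{\phi_i\}_{i\in I}$. $I_0=\{i\in I:A_i\notin\partial D\}$, $n_0=\mathrm{card}(I_0)$; $I_E=\{i\in I:A_i\in\overline E\}$, $n_E=\mathrm{card}(I_E)$. $G,U,R,V\in\mathbb{R}^n$ are the coefficient vectors of $g_h,u_h,r_h,v_h\in\mathbb{W}_h$, and $y_h=\sum_{i\in I_0}Y_i\phi_i$. Matrices: $K=(\int_D\nabla\phi_j\cdot\nabla\phi_i)_{i,j\in I_0}$, $B^1(G,\epsilon)=(\int_D(g_h+\epsilon)_+^2\phi_j\phi_i)_{i\in I_0,j\in I}$, $C^1(G,\epsilon,U)=(\int_D2(g_h+\epsilon)_+u_h\phi_j\phi_i)_{i\in I_0,j\in I}$, $F=(\int_Df\phi_i)_{i\in I_0}^T$; the discrete state $Y\in\mathbb{R}^{n_0}$ solves $KY=F+B^1(G,\epsilon)U$. Discrete trajectory: let $\mathbf{z}_g=(z_g^1,z_g^2)$ be the $T_g$-periodic solution of the Hamiltonian system $(z_g^1)'=-\partial_2g(\mathbf{z}_g)$,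 $(z_g^2)'=\partial_1g(\mathbf{z}_g)$, $\mathbf{z}_g(0)=(x_1^0,x_2^0)$, $g(x_1^0,x_2^0)=0$, where $g_h$ is the finite element approximation of $g$. On a partition $0=t_0<\dots<t_m=T_g$: $Z_0=(x_1^0,x_2^0)$, $Z_{k+1}^1=Z_k^1-(t_{k+1}-t_k)\frac{\partial g_h}{\partial x_2}(Z_k)$, $Z_{k+1}^2=Z_k^2+(t_{k+1}-t_k)\frac{\partial g_h}{\partial x_1}(Z_k)$ for $k=0,\dots,m-2$, and $Z_m=Z_0$ is imposed. $Z(t)$ is the piecewise affine interpolant with $Z(t_k)=Z_k$, and $Z'(t)=\frac{Z_{k+1}-Z_k}{t_{k+1}-t_k}$ for $t_k\le t<t_{k+1}$. Discrete derivatives: for $i\in I$, $J_i$ is the set of indices $j$ such that the triangle $T_j$ has vertex $A_i$, and for $\ell=1,2$, $(\Pi_h^\ell G)_i=\frac{1}{\sum_{j\in J_i}\mathrm{area}(T_j)}\sum_{j\in J_i}\mathrm{area}(T_j)\,\partial_\ell g_h|_{T_j}$ ($\Pi_h^1,\Pi_h^2$ are $n\times n$ matrices); $\partial_\ell^hg_h=\sum_{i\in I}(\Pi_h^\ell G)_i\phi_i$, $\nabla_hg_h=(\partial_1^hg_h,\partial_2^hg_h)$; likewise for any element of $\mathbb{W}_h$. Discrete variation of the trajectory in the direction $R$: $W_0=(0,0)$ and, for $k=0,\dots,m-1$, $W_{k+1}^1=W_k^1-(t_{k+1}-t_k)\nabla_h\partial_2^hg_h(Z_k)\cdot W_k-(t_{k+1}-t_k)\partial_2^hr_h(Z_k)$,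 $W_{k+1}^2=W_k^2+(t_{k+1}-t_k)\nabla_h\partial_1^hg_h(Z_k)\cdot W_k+(t_{k+1}-t_k)\partial_1^hr_h(Z_k)$; $W^\ell=(W_k^\ell)_{1\le k\le m}^T\in\mathbb{R}^m$. The $m\times n$ matrices $B^2(G,Z)$, $B^3(G,Z)$ are those of the linear maps $R\mapsto W^1=B^2(G,Z)R$ and $R\mapsto W^2=B^3(G,Z)R$. $N(Z)=(\int_0^{T_g}\phi_j(Z(t))\phi_i(Z(t))|Z'(t)|\,dt)_{i,j\in I_0}$; $L:\mathbb{R}^{n_0}\to\mathbb{R}^{n_E}$ is the (nonlinear) map such that $\partial_2j(\mathbf{x},y_h(\mathbf{x}))=\sum_{i\in I_E}(L(Y))_i\,\phi_i|_E(\mathbf{x})$; $M_{ED}=(\int_E\phi_i\phi_j\,d\mathbf{x})_{i\in I_E,j\in I_0}$. Discrete cost: $J(G,U)=\int_Ej(\mathbf{x},y_h(\mathbf{x}))\,d\mathbf{x}+\frac1\epsilon Y^TN(Z)Y$. Vector functions ($\mathbb{R}^2$-valued, components denoted by superscripts $1,2$): $\Lambda_1(t)=y_h(Z(t))\nabla y_h(Z(t))|Z'(t)|$, $\Lambda_2(t)=\frac{(y_h(Z(t)))^2}{|Z'(t)|}Z'(t)$, $\Lambda_3(t)=\frac{(y_h(Z(t)))^2}{|Z'(t)|}C(t)$ with $C(t)=[-(z_g^1)'\partial_{1,2}^2g(\mathbf{z}_g)+(z_g^2)'\partial_{1,1}^2g(\mathbf{z}_g),\ -(z_g^1)'\partial_{2,2}^2g(\mathbf{z}_g)+(z_g^2)'\partial_{2,1}^2g(\mathbf{z}_g)](t)$.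 For $\ell=1,2$: $\widetilde\Lambda_1^\ell\in\mathbb{R}^m$ has components $(t_{k+1}-t_{k-1})\Lambda_1^\ell(t_k)$, $1\le k\le m-1$, and last component $(t_m-t_{m-1})\Lambda_1^\ell(t_m)$; $\widetilde\Lambda_3^\ell\in\mathbb{R}^m$ has components $\frac12(t_{k+1}-t_{k-1})\Lambda_3^\ell(t_k)$, $1\le k\le m-1$, and last component $\frac12(t_m-t_{m-1})\Lambda_3^\ell(t_m)$; $\widetilde\Lambda_2^\ell=\frac12\sum_{k=0}^{m-1}(t_{k+1}-t_k)\big(\Lambda_2^\ell(t_k)\Phi(Z_k)+\Lambda_2^\ell(t_{k+1})\Phi(Z_{k+1})\big)\in\mathbb{R}^n$ with $\Phi(Z_k)=(\phi_i(Z_k))_{i\in I}^T$. The discrete derivative of $J$ at $(G,U)$ in the direction $(R,V)\in\mathbb{R}^n\times\mathbb{R}^n$ is $$dJ_{(G,U)}(R,V)=\Big((L(Y))^TM_{ED}+\tfrac2\epsilon Y^TN(Z)\Big)K^{-1}\big(B^1(G,\epsilon)V+C^1(G,\epsilon,U)R\big)+\tfrac1\epsilon\Big((\widetilde\Lambda_1^1)^TW^1+(\widetilde\Lambda_1^2)^TW^2\Big)$$ $$+\tfrac1\epsilon\Big(-(\widetilde\Lambda_2^1)^T(\Pi_h^2R)+(\widetilde\Lambda_2^2)^T(\Pi_h^1R)\Big)+\tfrac1\epsilon\Big((\widetilde\Lambda_3^1)^TW^1+(\widetilde\Lambda_3^2)^TW^2\Big).$$ $(R,V)$ is called a descent direction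 for $J$ at $(G,U)$ if $dJ_{(G,U)}(R,V)<0$.
   Formalization: The direction (R**,V* ) is additionally assumed not to be (0,0); at a stationary point (for example f=0, U=0, Y=0, j=0) it vanishes and dJ=0, so the strict inequality claimed would fail. *)

theory Defs
  imports
    "HOL-Analysis.Analysis"
    "Jordan_Normal_Form.Gauss_Jordan_Elimination"
begin

(* The symbols $ and \<bullet> refer to the vectors of Jordan_Normal_Form; points of the plane are
   pairs and their inner product is written inner. *)
unbundle no vec_syntax
unbundle no inner_syntax

type_synonym point = "real \<times> real"

section \<open>Partial derivatives and the Hamiltonian trajectory\<close>

definition pd1 :: "(point \<Rightarrow> real) \<Rightarrow> point \<Rightarrow> real" where
  "pd1 g x = deriv (\<lambda>s. g (s, snd x)) (fst x)"

definition pd2 :: "(point \<Rightarrow> real) \<Rightarrow> point \<Rightarrow> real" where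
  "pd2 g x = deriv (\<lambda>s. g (fst x, s)) (snd x)"

definition C2_on :: "point set \<Rightarrow> (point \<Rightarrow> real) \<Rightarrow> bool" where
  "C2_on S g \<longleftrightarrow>
     (\<forall>x\<in>S. g differentiable (at x) \<and> pd1 g differentiable (at x) \<and> pd2 g differentiable (at x)) \<and>
     continuous_on S (pd1 (pd1 g)) \<and> continuous_on S (pd1 (pd2 g)) \<and>
     continuous_on S (pd2 (pd1 g)) \<and> continuous_on S (pd2 (pd2 g))"

definition hamiltonian_orbit ::
    "point set \<Rightarrow> (point \<Rightarrow> real) \<Rightarrow> point \<Rightarrow> real \<Rightarrow> (real \<Rightarrow> point) \<Rightarrow> bool" where
  "hamiltonian_orbit D g x0 Tg z \<longleftrightarrow>
     0 < Tg \<and> g x0 = 0 \<and> z 0 = x0 \<and> (\<forall>t. z (t + Tg) = z t) \<and>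
     (\<forall>t. z t \<in> D \<and> (z has_vector_derivative (- pd2 g (z t), pd1 g (z t))) (at t))"

section \<open>Polygonal domains, triangulations and finite elements\<close>

definition polygonal_domain :: "point set \<Rightarrow> bool" where
  "polygonal_domain D \<longleftrightarrow> open D \<and> connected D \<and> D \<noteq> {} \<and> bounded D \<and>
     (\<exists>S. finite S \<and> (\<forall>(a, b)\<in>S. a \<noteq> b) \<and> frontier D = (\<Union>(a, b)\<in>S. closed_segment a b))"

(* The vertices are numbered 0, ..., nv - 1, so I = {..<nv}. The field side chooses, for each point
   of the closure of D, a triangle containing it; on the edges the gradient of an element of W_h is
   two-valued and this choice says which value is used. Any choice is allowed. *)
record mesh =
  mdom :: "point set"
  msub :: "point set"
  tris :: "point set set"
  nv :: nat
  vert :: "nat \<Rightarrow> point"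
  hat :: "nat \<Rightarrow> point \<Rightarrow> real"
  side :: "point \<Rightarrow> point set"

definition fe_space :: "mesh \<Rightarrow> (point \<Rightarrow> real) set" where
  "fe_space M = {w. continuous_on (closure (mdom M)) w \<and>
     (\<forall>T\<in>tris M. \<exists>c b. \<forall>x\<in>T. w x = inner c x + b)}"

definition admissible_mesh :: "mesh \<Rightarrow> bool" where
  "admissible_mesh M \<longleftrightarrow>
     triangulation (tris M) \<and> (\<forall>T\<in>tris M. 2 simplex T) \<and> \<Union>(tris M) = closure (mdom M) \<and>
     (\<forall>T\<in>tris M. T \<subseteq> closure (msub M) \<or> T \<subseteq> closure (mdom M - msub M)) \<and>
     bij_betw (vert M) {..<nv M} {x. \<exists>T\<in>tris M. x extreme_point_of T} \<and>
     (\<forall>i<nv M. hat M i \<in> fe_space M) \<and>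
     (\<forall>i<nv M. \<forall>k<nv M. hat M i (vert M k) = (if i = k then 1 else 0)) \<and>
     (\<forall>x\<in>closure (mdom M). side M x \<in> tris M \<and> x \<in> side M x)"

definition I0 :: "mesh \<Rightarrow> nat set" where
  "I0 M = {i. i < nv M \<and> vert M i \<notin> frontier (mdom M)}"

definition IE :: "mesh \<Rightarrow> nat set" where
  "IE M = {i. i < nv M \<and> vert M i \<in> closure (msub M)}"

abbreviation n0 :: "mesh \<Rightarrow> nat" where "n0 M \<equiv> card (I0 M)"
abbreviation nE :: "mesh \<Rightarrow> nat" where "nE M \<equiv> card (IE M)"

(* Vectors and matrices indexed by I0 or IE are stored with positions 0, ..., card - 1;
   nth_index S a is the element of S at position a in increasing order. *)
definition nth_index :: "nat set \<Rightarrow> nat \<Rightarrow> nat" where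
  "nth_index S a = sorted_list_of_set S ! a"

abbreviation hat0 :: "mesh \<Rightarrow> nat \<Rightarrow> point \<Rightarrow> real" where
  "hat0 M a \<equiv> hat M (nth_index (I0 M) a)"
abbreviation hatE :: "mesh \<Rightarrow> nat \<Rightarrow> point \<Rightarrow> real" where
  "hatE M a \<equiv> hat M (nth_index (IE M) a)"

(* The element of W_h with coefficient vector G. *)
definition fe :: "mesh \<Rightarrow> real vec \<Rightarrow> point \<Rightarrow> real" where
  "fe M G x = (\<Sum>i<nv M. G $ i * hat M i x)"

definition state :: "mesh \<Rightarrow> real vec \<Rightarrow> point \<Rightarrow> real" where
  "state M Y x = (\<Sum>a<n0 M. Y $ a * hat0 M a x)"

(* The constant gradient of a function that is affine on the triangle T. *)
definition grad_on :: "point set \<Rightarrow> (point \<Rightarrow> real) \<Rightarrow> point" where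
  "grad_on T w = (THE c. \<forall>x\<in>T. \<forall>y\<in>T. w y - w x = inner c (y - x))"

definition grad :: "mesh \<Rightarrow> (point \<Rightarrow> real) \<Rightarrow> point \<Rightarrow> point" where
  "grad M w x = grad_on (side M x) w"

section \<open>Matrices\<close>

(* The row vector v^T A, stored as a vector. *)
definition row_mult :: "real vec \<Rightarrow> real mat \<Rightarrow> real vec" (infixl \<open>\<^sub>v*\<close> 70) where
  "v \<^sub>v* A = A\<^sup>T *\<^sub>v v"

definition matrix_of_map :: "nat \<Rightarrow> nat \<Rightarrow> (real vec \<Rightarrow> real vec) \<Rightarrow> real mat" where
  "matrix_of_map nr nc F = mat nr nc (\<lambda>(i, j). F (unit_vec nc j) $ i)"

(* mat_inverse A is None exactly when the square matrix A is singular; the value is then set to 0,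
   like the inverse of 0 in a field. *)
definition inv_mat :: "real mat \<Rightarrow> real mat" where
  "inv_mat A = (case mat_inverse A of Some B \<Rightarrow> B | None \<Rightarrow> 0\<^sub>m (dim_row A) (dim_row A))"

definition pos :: "real \<Rightarrow> real" where
  "pos s = max s 0"

definition Kmat :: "mesh \<Rightarrow> real mat" where
  "Kmat M = mat (n0 M) (n0 M) (\<lambda>(a, b).
     LINT x:mdom M|lebesgue. inner (grad M (hat0 M b) x) (grad M (hat0 M a) x))"

definition B1mat :: "mesh \<Rightarrow> real vec \<Rightarrow> real \<Rightarrow> real mat" where
  "B1mat M G \<epsilon> = mat (n0 M) (nv M) (\<lambda>(a, k).
     LINT x:mdom M|lebesgue. (pos (fe M G x + \<epsilon>))\<^sup>2 * hat M k x * hat0 M a x)"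

definition C1mat :: "mesh \<Rightarrow> real vec \<Rightarrow> real \<Rightarrow> real vec \<Rightarrow> real mat" where
  "C1mat M G \<epsilon> U = mat (n0 M) (nv M) (\<lambda>(a, k).
     LINT x:mdom M|lebesgue. 2 * pos (fe M G x + \<epsilon>) * fe M U x * hat M k x * hat0 M a x)"

definition Fvec :: "mesh \<Rightarrow> (point \<Rightarrow> real) \<Rightarrow> real vec" where
  "Fvec M f = vec (n0 M) (\<lambda>a. LINT x:mdom M|lebesgue. f x * hat0 M a x)"

definition MED :: "mesh \<Rightarrow> real mat" where
  "MED M = mat (nE M) (n0 M) (\<lambda>(a, b). LINT x:msub M|lebesgue. hatE M a x * hat0 M b x)"

(* L represents, in the basis of the hat functions of IE restricted to E, the map
   Y \<mapsto> d/ds j(x, s) at s = y_h(x). *)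
definition represents_d2 ::
    "mesh \<Rightarrow> (point \<Rightarrow> real \<Rightarrow> real) \<Rightarrow> (real vec \<Rightarrow> real vec) \<Rightarrow> bool" where
  "represents_d2 M j L \<longleftrightarrow> (\<forall>Y\<in>carrier_vec (n0 M). L Y \<in> carrier_vec (nE M) \<and>
     (\<forall>x\<in>msub M.
       (j x has_real_derivative (\<Sum>a<nE M. L Y $ a * hatE M a x)) (at (state M Y x))))"

section \<open>Discrete derivatives\<close>

(* Here and below, a coordinate l = 1, 2 of the plane is given by its projection c = fst, snd. *)
definition dcoef :: "mesh \<Rightarrow> (point \<Rightarrow> real) \<Rightarrow> real vec \<Rightarrow> real vec" where
  "dcoef M c G = vec (nv M) (\<lambda>i.
     let J = {T\<in>tris M. vert M i extreme_point_of T} in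
     1 / (\<Sum>T\<in>J. measure lebesgue T) *
       (\<Sum>T\<in>J. measure lebesgue T * c (grad_on T (fe M G))))"

definition Pimat :: "mesh \<Rightarrow> (point \<Rightarrow> real) \<Rightarrow> real mat" where
  "Pimat M c = matrix_of_map (nv M) (nv M) (dcoef M c)"

definition pdh :: "mesh \<Rightarrow> (point \<Rightarrow> real) \<Rightarrow> real vec \<Rightarrow> point \<Rightarrow> real" where
  "pdh M c G = fe M (dcoef M c G)"

definition gradh :: "mesh \<Rightarrow> real vec \<Rightarrow> point \<Rightarrow> point" where
  "gradh M G x = (pdh M fst G x, pdh M snd G x)"

section \<open>Discrete trajectory and its variation\<close>

record trajectory =
  steps :: nat
  tm :: "nat \<Rightarrow> real"
  node :: "nat \<Rightarrow> point"
  path :: "real \<Rightarrow> point"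
  vel :: "real \<Rightarrow> point"

abbreviation dt :: "trajectory \<Rightarrow> nat \<Rightarrow> real" where
  "dt \<tau> k \<equiv> tm \<tau> (Suc k) - tm \<tau> k"

(* vel is Z'. Its value at the final time, which enters the last components of the vectors
   Lam1t, Lam2t and Lam3t below, is left arbitrary: the formula for Z' covers t < t_m only. *)
definition discrete_trajectory ::
    "mesh \<Rightarrow> real vec \<Rightarrow> point \<Rightarrow> real \<Rightarrow> trajectory \<Rightarrow> bool" where
  "discrete_trajectory M G x0 Tg \<tau> \<longleftrightarrow>
     tm \<tau> 0 = 0 \<and> tm \<tau> (steps \<tau>) = Tg \<and> (\<forall>k<steps \<tau>. tm \<tau> k < tm \<tau> (Suc k)) \<and>
     node \<tau> 0 = x0 \<and> node \<tau> (steps \<tau>) = node \<tau> 0 \<and>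
     (\<forall>k. Suc k < steps \<tau> \<longrightarrow>
        fst (node \<tau> (Suc k)) = fst (node \<tau> k) - dt \<tau> k * snd (grad M (fe M G) (node \<tau> k)) \<and>
        snd (node \<tau> (Suc k)) = snd (node \<tau> k) + dt \<tau> k * fst (grad M (fe M G) (node \<tau> k))) \<and>
     (\<forall>k<steps \<tau>. \<forall>s\<in>{tm \<tau> k..tm \<tau> (Suc k)}.
        path \<tau> s = node \<tau> k + ((s - tm \<tau> k) / dt \<tau> k) *\<^sub>R (node \<tau> (Suc k) - node \<tau> k)) \<and>
     (\<forall>k<steps \<tau>. \<forall>s\<in>{tm \<tau> k..<tm \<tau> (Suc k)}.
        vel \<tau> s = (1 / dt \<tau> k) *\<^sub>R (node \<tau> (Suc k) - node \<tau> k))"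

primrec Wvar :: "mesh \<Rightarrow> real vec \<Rightarrow> trajectory \<Rightarrow> real vec \<Rightarrow> nat \<Rightarrow> point" where
  "Wvar M G \<tau> R 0 = (0, 0)"
| "Wvar M G \<tau> R (Suc k) = (let W = Wvar M G \<tau> R k; Z = node \<tau> k in
     (fst W - dt \<tau> k * inner (gradh M (dcoef M snd G) Z) W - dt \<tau> k * pdh M snd R Z,
      snd W + dt \<tau> k * inner (gradh M (dcoef M fst G) Z) W + dt \<tau> k * pdh M fst R Z))"

(* The vector (W_1^l, ..., W_m^l); the position a holds the entry with k = a + 1. *)
definition Wvec ::
    "mesh \<Rightarrow> real vec \<Rightarrow> trajectory \<Rightarrow> (point \<Rightarrow> real) \<Rightarrow> real vec \<Rightarrow> real vec" where
  "Wvec M G \<tau> c R = vec (steps \<tau>) (\<lambda>a. c (Wvar M G \<tau> R (Suc a)))"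

definition B2mat :: "mesh \<Rightarrow> real vec \<Rightarrow> trajectory \<Rightarrow> real mat" where
  "B2mat M G \<tau> = matrix_of_map (steps \<tau>) (nv M) (Wvec M G \<tau> fst)"

definition B3mat :: "mesh \<Rightarrow> real vec \<Rightarrow> trajectory \<Rightarrow> real mat" where
  "B3mat M G \<tau> = matrix_of_map (steps \<tau>) (nv M) (Wvec M G \<tau> snd)"

definition Nmat :: "mesh \<Rightarrow> trajectory \<Rightarrow> real mat" where
  "Nmat M \<tau> = mat (n0 M) (n0 M) (\<lambda>(a, b).
     LINT s:{0..tm \<tau> (steps \<tau>)}|lebesgue.
       hat0 M b (path \<tau> s) * hat0 M a (path \<tau> s) * norm (vel \<tau> s))"

section \<open>Cost and its discrete derivative\<close>

definition cost ::
    "mesh \<Rightarrow> trajectory \<Rightarrow> real \<Rightarrow> (point \<Rightarrow> real \<Rightarrow> real) \<Rightarrow> real vec \<Rightarrow> real" where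
  "cost M \<tau> \<epsilon> j Y =
     (LINT x:msub M|lebesgue. j x (state M Y x)) + 1 / \<epsilon> * (Y \<bullet> (Nmat M \<tau> *\<^sub>v Y))"

definition Lam1 :: "mesh \<Rightarrow> trajectory \<Rightarrow> real vec \<Rightarrow> real \<Rightarrow> point" where
  "Lam1 M \<tau> Y s =
     (state M Y (path \<tau> s) * norm (vel \<tau> s)) *\<^sub>R grad M (state M Y) (path \<tau> s)"

definition Lam2 :: "mesh \<Rightarrow> trajectory \<Rightarrow> real vec \<Rightarrow> real \<Rightarrow> point" where
  "Lam2 M \<tau> Y s = ((state M Y (path \<tau> s))\<^sup>2 / norm (vel \<tau> s)) *\<^sub>R vel \<tau> s"

definition Cfun :: "(point \<Rightarrow> real) \<Rightarrow> (real \<Rightarrow> point) \<Rightarrow> real \<Rightarrow> point" where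
  "Cfun g z s = (let z' = vector_derivative z (at s) in
     (- fst z' * pd1 (pd2 g) (z s) + snd z' * pd1 (pd1 g) (z s),
      - fst z' * pd2 (pd2 g) (z s) + snd z' * pd2 (pd1 g) (z s)))"

definition Lam3 ::
    "mesh \<Rightarrow> trajectory \<Rightarrow> (point \<Rightarrow> real) \<Rightarrow> (real \<Rightarrow> point) \<Rightarrow> real vec \<Rightarrow> real \<Rightarrow> point" where
  "Lam3 M \<tau> g z Y s = ((state M Y (path \<tau> s))\<^sup>2 / norm (vel \<tau> s)) *\<^sub>R Cfun g z s"

definition Lam1t ::
    "mesh \<Rightarrow> trajectory \<Rightarrow> real vec \<Rightarrow> (point \<Rightarrow> real) \<Rightarrow> real vec" where
  "Lam1t M \<tau> Y c = vec (steps \<tau>) (\<lambda>a. let k = Suc a in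
     (if k < steps \<tau> then tm \<tau> (k + 1) - tm \<tau> (k - 1) else tm \<tau> k - tm \<tau> (k - 1)) *
       c (Lam1 M \<tau> Y (tm \<tau> k)))"

definition Lam2t ::
    "mesh \<Rightarrow> trajectory \<Rightarrow> real vec \<Rightarrow> (point \<Rightarrow> real) \<Rightarrow> real vec" where
  "Lam2t M \<tau> Y c = vec (nv M) (\<lambda>i. 1 / 2 * (\<Sum>k<steps \<tau>. dt \<tau> k *
     (c (Lam2 M \<tau> Y (tm \<tau> k)) * hat M i (node \<tau> k) +
      c (Lam2 M \<tau> Y (tm \<tau> (k + 1))) * hat M i (node \<tau> (k + 1)))))"

definition Lam3t ::
    "mesh \<Rightarrow> trajectory \<Rightarrow> (point \<Rightarrow> real) \<Rightarrow> (real \<Rightarrow> point) \<Rightarrow> real vec \<Rightarrow>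
     (point \<Rightarrow> real) \<Rightarrow> real vec" where
  "Lam3t M \<tau> g z Y c = vec (steps \<tau>) (\<lambda>a. let k = Suc a in
     1 / 2 * (if k < steps \<tau> then tm \<tau> (k + 1) - tm \<tau> (k - 1) else tm \<tau> k - tm \<tau> (k - 1)) *
       c (Lam3 M \<tau> g z Y (tm \<tau> k)))"

definition adj_row ::
    "mesh \<Rightarrow> trajectory \<Rightarrow> real \<Rightarrow> (real vec \<Rightarrow> real vec) \<Rightarrow> real vec \<Rightarrow> real vec" where
  "adj_row M \<tau> \<epsilon> L Y = L Y \<^sub>v* MED M + (2 / \<epsilon>) \<cdot>\<^sub>v (Y \<^sub>v* Nmat M \<tau>)"

(* The discretised derivative of cost; by definition it is this expression, not the exact
   derivative of the discrete cost. *)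
definition dJ ::
    "mesh \<Rightarrow> trajectory \<Rightarrow> real \<Rightarrow> (real vec \<Rightarrow> real vec) \<Rightarrow> (point \<Rightarrow> real) \<Rightarrow>
     (real \<Rightarrow> point) \<Rightarrow> real vec \<Rightarrow> real vec \<Rightarrow> real vec \<Rightarrow> real vec \<Rightarrow> real vec \<Rightarrow> real" where
  "dJ M \<tau> \<epsilon> L g z Y G U R V =
     adj_row M \<tau> \<epsilon> L Y \<bullet> (inv_mat (Kmat M) *\<^sub>v (B1mat M G \<epsilon> *\<^sub>v V + C1mat M G \<epsilon> U *\<^sub>v R))
     + 1 / \<epsilon> * (Lam1t M \<tau> Y fst \<bullet> Wvec M G \<tau> fst R + Lam1t M \<tau> Y snd \<bullet> Wvec M G \<tau> snd R)
     + 1 / \<epsilon> * (- (Lam2t M \<tau> Y fst \<bullet> (Pimat M snd *\<^sub>v R)) + Lam2t M \<tau> Y snd \<bullet> (Pimat M fst *\<^sub>v R))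
     + 1 / \<epsilon> * (Lam3t M \<tau> g z Y fst \<bullet> Wvec M G \<tau> fst R + Lam3t M \<tau> g z Y snd \<bullet> Wvec M G \<tau> snd R)"

definition descent_direction ::
    "mesh \<Rightarrow> trajectory \<Rightarrow> real \<Rightarrow> (real vec \<Rightarrow> real vec) \<Rightarrow> (point \<Rightarrow> real) \<Rightarrow>
     (real \<Rightarrow> point) \<Rightarrow> real vec \<Rightarrow> real vec \<Rightarrow> real vec \<Rightarrow> real vec \<Rightarrow> real vec \<Rightarrow> bool" where
  "descent_direction M \<tau> \<epsilon> L g z Y G U R V \<longleftrightarrow>
     R \<in> carrier_vec (nv M) \<and> V \<in> carrier_vec (nv M) \<and> dJ M \<tau> \<epsilon> L g z Y G U R V < 0"

end

theory Submission
  imports Defs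
begin

text \<open>
  The trajectory variation and the discrete derivatives depend linearly on the direction, so they
  are given by their matrices, and transposition turns the discrete derivative into
  $dJ(R, V) = p \cdot R + q \cdot V$ with covectors $p$, $q$ independent of the direction. The
  proposed direction is $R = -p$, $V = -q$, whence $dJ(R, V) = -|R|^2 - |V|^2 < 0$.
\<close>

section \<open>Row vectors and transposition\<close>

lemma row_mult_carrier [simp]: "A \<in> carrier_mat nr nc \<Longrightarrow> v \<^sub>v* A \<in> carrier_vec nc"
  unfolding row_mult_def carrier_vec_def by (simp add: carrier_matD(2))

lemma row_mult_scalar_prod:
  assumes "A \<in> carrier_mat nr nc" "v \<in> carrier_vec nr" "w \<in> carrier_vec nc"
  shows "(v \<^sub>v* A) \<bullet> w = v \<bullet> (A *\<^sub>v w)"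
  unfolding row_mult_def by (rule transpose_vec_mult_scalar[OF assms(1,3,2)])

text \<open>Both outcomes of \<open>mat_inverse\<close> give size \<open>n\<close>: the true
  inverse, and the zero matrix chosen for singular \<open>A\<close>. Moving the matrix across a
  scalar product uses its shape only.\<close>

lemma inv_mat_carrier:
  assumes "A \<in> carrier_mat n n"
  shows "inv_mat A \<in> carrier_mat n n"
  using assms mat_inverse(2)[OF assms] by (auto simp: inv_mat_def split: option.splits)

section \<open>Matrices of linear maps\<close>

lemma linear_functional_expansion:
  fixes \<phi> :: "real vec \<Rightarrow> real"
  assumes lin: "\<And>a x y. x \<in> carrier_vec n \<Longrightarrow> y \<in> carrier_vec n \<Longrightarrow>
      \<phi> (a \<cdot>\<^sub>v x + y) = a * \<phi> x + \<phi> y"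
    and x: "x \<in> carrier_vec n"
  shows "\<phi> x = (\<Sum>i<n. \<phi> (unit_vec n i) * x $ i)"
proof -
  \<comment> \<open>Induction over the truncations of \<open>x\<close> to its first \<open>k\<close>
    entries: each step adds one multiple of a unit vector, which is a single use of
    \<open>lin\<close>.\<close>
  have "\<phi> (vec n (\<lambda>i. if i < k then x $ i else 0)) = (\<Sum>i<k. \<phi> (unit_vec n i) * x $ i)"
    if "k \<le> n" for k
    using that
  proof (induction k)
    case 0
    \<comment> \<open>At zero vectors with factor 1, \<open>lin\<close> says that the value at zero
      is twice itself.\<close>
    have "1 \<cdot>\<^sub>v 0\<^sub>v n + 0\<^sub>v n = (0\<^sub>v n :: real vec)" by simp
    then have "\<phi> (0\<^sub>v n) = 0" using lin[of "0\<^sub>v n" "0\<^sub>v n" 1] by simp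
    moreover have "vec n (\<lambda>i. if i < 0 then x $ i else 0) = 0\<^sub>v n" by auto
    ultimately show ?case by simp
  next
    case (Suc k)
    have "vec n (\<lambda>i. if i < Suc k then x $ i else 0) =
        x $ k \<cdot>\<^sub>v unit_vec n k + vec n (\<lambda>i. if i < k then x $ i else 0)"
      using Suc.prems by (intro eq_vecI) (auto simp: less_Suc_eq)
    then show ?case using Suc by (simp add: lin mult.commute)
  qed
  note this[of n]
  moreover have "vec n (\<lambda>i. if i < n then x $ i else 0) = x"
    using x by auto
  ultimately show ?thesis by simp
qed

text \<open>Each component of \<open>F\<close> is a linear functional whose values at the unit
  vectors form a row of the matrix, so its expansion is the matrix product.\<close>

lemma matrix_of_map_mult:
  assumes lin: "\<And>a x y. x \<in> carrier_vec nc \<Longrightarrow> y \<in> carrier_vec nc \<Longrightarrow>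
      F (a \<cdot>\<^sub>v x + y) = a \<cdot>\<^sub>v F x + F y"
    and F: "\<And>x. F x \<in> carrier_vec nr"
    and x: "x \<in> carrier_vec nc"
  shows "matrix_of_map nr nc F *\<^sub>v x = F x"
proof (rule eq_vecI)
  fix i assume "i < dim_vec (F x)"
  then have i: "i < nr" using F[of x] by auto
  have dims: "dim_vec (F u) = nr" for u using F[of u] by auto
  have "F x $ i = (\<Sum>k<nc. F (unit_vec nc k) $ i * x $ k)"
    by (rule linear_functional_expansion[OF _ x]) (use i in \<open>simp add: lin dims\<close>)
  then show "(matrix_of_map nr nc F *\<^sub>v x) $ i = F x $ i"
    using i x by (simp add: matrix_of_map_def scalar_prod_def atLeast0LessThan)
qed (use F[of x] in \<open>auto simp: matrix_of_map_def\<close>)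

lemma matrix_of_map_carrier: "matrix_of_map nr nc F \<in> carrier_mat nr nc"
  by (simp add: matrix_of_map_def)

section \<open>Linearity of the discrete derivatives and of the trajectory variation\<close>

lemma fe_linear:
  assumes "x \<in> carrier_vec (nv M)" "y \<in> carrier_vec (nv M)"
  shows "fe M (a \<cdot>\<^sub>v x + y) p = a * fe M x p + fe M y p"
  using assms by (simp add: fe_def algebra_simps sum.distrib sum_distrib_left)

lemma fe_affine_on_triangle:
  assumes "admissible_mesh M" "T \<in> tris M"
  shows "\<exists>c b. \<forall>x\<in>T. fe M G x = inner c x + b"
proof -
  have "\<forall>i\<in>{..<nv M}. \<exists>c b. \<forall>x\<in>T. hat M i x = inner c x + b"
    using assms by (simp add: admissible_mesh_def fe_space_def)
  then obtain c b where cb: "\<And>i x. i < nv M \<Longrightarrow> x \<in> T \<Longrightarrow> hat M i x = inner (c i) x + b i"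
    by (metis lessThan_iff)
  have "fe M G x = inner (\<Sum>i<nv M. G $ i *\<^sub>R c i) x + (\<Sum>i<nv M. G $ i * b i)" if "x \<in> T" for x
    using that by (simp add: fe_def cb inner_sum_left algebra_simps sum.distrib)
  then show ?thesis by blast
qed

text \<open>\<open>grad_on\<close> is a definite description, so uniqueness must be shown: two
  slopes of \<open>w\<close> on \<open>T\<close> differ by a vector orthogonal to all edges, and a
  nondegenerate triangle in the plane admits only zero.\<close>

lemma grad_on_eqI:
  assumes T: "2 simplex T" and c: "\<And>x. x \<in> T \<Longrightarrow> w x = inner c x + b"
  shows "grad_on T w = c"
  unfolding grad_on_def
proof (rule the_equality)
  show "\<forall>x\<in>T. \<forall>y\<in>T. w y - w x = inner c (y - x)"
    by (simp add: c inner_diff_right)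
next
  fix c' assume c': "\<forall>x\<in>T. \<forall>y\<in>T. w y - w x = inner c' (y - x)"
  have dim: "aff_dim T = 2" using aff_dim_simplex[OF T] by simp
  then obtain x0 where x0: "x0 \<in> T"
    by (metis aff_dim_empty all_not_in_conv neg_one_neq_numeral)
  \<comment> \<open>For \<open>c' \<noteq> c\<close> the right-hand side is a line, of dimension 1,
    and cannot contain \<open>T\<close>, of dimension 2.\<close>
  have "T \<subseteq> {y. inner (c' - c) y = inner (c' - c) x0}"
    using c' x0 by (force simp: c inner_diff_left inner_diff_right)
  then have "aff_dim T \<le> aff_dim {y. inner (c' - c) y = inner (c' - c) x0}"
    by (rule aff_dim_subset)
  then show "c' = c"
    using dim aff_dim_hyperplane[of "c' - c" "inner (c' - c) x0"] by (cases "c' = c") auto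
qed

text \<open>A definite description is not visibly linear. Affinity on \<open>T\<close> supplies
  explicit slopes \<open>c\<close> and \<open>d\<close>, and all three gradients are then read off
  from them.\<close>

lemma grad_on_fe_linear:
  assumes M: "admissible_mesh M" "T \<in> tris M"
    and xy: "x \<in> carrier_vec (nv M)" "y \<in> carrier_vec (nv M)"
  shows "grad_on T (fe M (a \<cdot>\<^sub>v x + y)) = a *\<^sub>R grad_on T (fe M x) + grad_on T (fe M y)"
proof -
  have T: "2 simplex T" using M by (simp add: admissible_mesh_def)
  obtain c b where c: "\<And>p. p \<in> T \<Longrightarrow> fe M x p = inner c p + b"
    using fe_affine_on_triangle[OF M] by metis
  obtain d e where d: "\<And>p. p \<in> T \<Longrightarrow> fe M y p = inner d p + e"
    using fe_affine_on_triangle[OF M] by metis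
  have "grad_on T (fe M (a \<cdot>\<^sub>v x + y)) = a *\<^sub>R c + d"
    by (rule grad_on_eqI[OF T, where b = "a * b + e"])
      (simp add: fe_linear[OF xy] c d inner_add_left algebra_simps)
  then show ?thesis
    using grad_on_eqI[OF T c] grad_on_eqI[OF T d] by simp
qed

lemma dcoef_carrier [simp]: "dcoef M c G \<in> carrier_vec (nv M)"
  by (simp add: dcoef_def)

text \<open>The areas and the set \<open>J\<close> depend on the mesh only, so the weighted average
  inherits linearity from the gradients.\<close>

lemma dcoef_linear:
  assumes M: "admissible_mesh M" and c: "linear c"
    and xy: "x \<in> carrier_vec (nv M)" "y \<in> carrier_vec (nv M)"
  shows "dcoef M c (a \<cdot>\<^sub>v x + y) = a \<cdot>\<^sub>v dcoef M c x + dcoef M c y"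
proof (rule eq_vecI)
  fix i assume "i < dim_vec (a \<cdot>\<^sub>v dcoef M c x + dcoef M c y)"
  then have i: "i < nv M" by (simp add: dcoef_def)
  define J where "J = {T\<in>tris M. vert M i extreme_point_of T}"
  have "(\<Sum>T\<in>J. measure lebesgue T * c (grad_on T (fe M (a \<cdot>\<^sub>v x + y)))) =
      a * (\<Sum>T\<in>J. measure lebesgue T * c (grad_on T (fe M x))) +
      (\<Sum>T\<in>J. measure lebesgue T * c (grad_on T (fe M y)))"
    unfolding sum_distrib_left sum.distrib[symmetric]
    by (rule sum.cong)
      (auto simp: J_def grad_on_fe_linear[OF M _ xy] linear_add[OF c] linear_scale[OF c] algebra_simps)
  then show "dcoef M c (a \<cdot>\<^sub>v x + y) $ i = (a \<cdot>\<^sub>v dcoef M c x + dcoef M c y) $ i"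
    using i by (simp add: dcoef_def J_def[symmetric] Let_def add_divide_distrib)
qed (simp add: dcoef_def)

lemma pdh_linear:
  assumes "admissible_mesh M" "linear c" "x \<in> carrier_vec (nv M)" "y \<in> carrier_vec (nv M)"
  shows "pdh M c (a \<cdot>\<^sub>v x + y) p = a * pdh M c x p + pdh M c y p"
  by (simp add: pdh_def dcoef_linear[OF assms] fe_linear)

text \<open>The recursion is jointly linear in the previous value and in \<open>R\<close>, with
  coefficients fixed by \<open>G\<close> and the trajectory, and it starts at zero.\<close>

lemma Wvar_linear:
  assumes "admissible_mesh M" "x \<in> carrier_vec (nv M)" "y \<in> carrier_vec (nv M)"
  shows "Wvar M G \<tau> (a \<cdot>\<^sub>v x + y) k = a *\<^sub>R Wvar M G \<tau> x k + Wvar M G \<tau> y k"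
proof (induction k)
  case (Suc k)
  show ?case
    using pdh_linear[OF assms(1) linear_fst assms(2,3), of a "node \<tau> k"]
      pdh_linear[OF assms(1) linear_snd assms(2,3), of a "node \<tau> k"]
    by (simp add: Let_def Suc.IH inner_add_right algebra_simps)
qed (simp add: zero_prod_def)

lemma Wvec_carrier [simp]: "Wvec M G \<tau> c R \<in> carrier_vec (steps \<tau>)"
  by (simp add: Wvec_def)

lemma Wvec_linear:
  assumes "admissible_mesh M" "linear c" "x \<in> carrier_vec (nv M)" "y \<in> carrier_vec (nv M)"
  shows "Wvec M G \<tau> c (a \<cdot>\<^sub>v x + y) = a \<cdot>\<^sub>v Wvec M G \<tau> c x + Wvec M G \<tau> c y"
  by (rule eq_vecI)
    \<comment> \<open>The recursion must stay folded at \<open>Suc a\<close> for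
      \<open>Wvar_linear\<close> to apply.\<close>
    (auto simp del: Wvar.simps simp add: Wvec_def Wvar_linear[OF assms(1,3,4)]
      linear_add[OF assms(2)] linear_scale[OF assms(2)])

text \<open>\<open>dJ\<close> contains the variation itself, the proposed direction its matrix; this
  lemma and its analogue for \<open>B3mat\<close> link the two.\<close>

lemma B2mat_mult:
  assumes "admissible_mesh M" "R \<in> carrier_vec (nv M)"
  shows "B2mat M G \<tau> *\<^sub>v R = Wvec M G \<tau> fst R"
  unfolding B2mat_def
  by (rule matrix_of_map_mult) (simp_all add: Wvec_linear assms linear_fst)

lemma B3mat_mult:
  assumes "admissible_mesh M" "R \<in> carrier_vec (nv M)"
  shows "B3mat M G \<tau> *\<^sub>v R = Wvec M G \<tau> snd R"
  unfolding B3mat_def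
  by (rule matrix_of_map_mult) (simp_all add: Wvec_linear assms linear_snd)

section \<open>Positivity and the descent direction\<close>

lemma scalar_prod_self_pos:
  fixes v :: "real vec"
  assumes "v \<in> carrier_vec n"
  shows "0 \<le> v \<bullet> v" and "v \<noteq> 0\<^sub>v n \<Longrightarrow> 0 < v \<bullet> v"
proof -
  have sq: "v \<bullet> v = (\<Sum>i<n. (v $ i)\<^sup>2)"
    using assms by (simp add: scalar_prod_def atLeast0LessThan power2_eq_square)
  then show "0 \<le> v \<bullet> v" by (simp add: sum_nonneg)
  assume "v \<noteq> 0\<^sub>v n"
  then obtain i where "i < n" "v $ i \<noteq> 0" using assms
    by (metis carrier_vecD eq_vecI index_zero_vec)
  then show "0 < v \<bullet> v" unfolding sq by (intro sum_pos2[of _ i]) auto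
qed

theorem proposition4p5:
  fixes D E :: "(real \<times> real) set" and M :: mesh and \<tau> :: trajectory
    and \<epsilon> Tg :: real and x0 :: "real \<times> real"
    and f g :: "real \<times> real \<Rightarrow> real" and j :: "real \<times> real \<Rightarrow> real \<Rightarrow> real"
    and z :: "real \<Rightarrow> real \<times> real"
    and L :: "real vec \<Rightarrow> real vec" and G U Y R V :: "real vec"
  assumes "polygonal_domain D" and "polygonal_domain E" and "closure E \<subseteq> D"
    and "\<epsilon> > 0"
    and "mdom M = D" and "msub M = E" and "admissible_mesh M"
    and "G \<in> carrier_vec (nv M)" and "U \<in> carrier_vec (nv M)"
    and "C2_on D g" and "hamiltonian_orbit D g x0 Tg z"
    and "discrete_trajectory M G x0 Tg \<tau>"
    and "represents_d2 M j L"
    and "Y \<in> carrier_vec (n0 M)" and "Kmat M *\<^sub>v Y = Fvec M f + B1mat M G \<epsilon> *\<^sub>v U"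
    and "V = - (adj_row M \<tau> \<epsilon> L Y \<^sub>v* inv_mat (Kmat M) \<^sub>v* B1mat M G \<epsilon>)"
    and "R = - (adj_row M \<tau> \<epsilon> L Y \<^sub>v* inv_mat (Kmat M) \<^sub>v* C1mat M G \<epsilon> U)
         - (1 / \<epsilon>) \<cdot>\<^sub>v (Lam1t M \<tau> Y fst \<^sub>v* B2mat M G \<tau> + Lam1t M \<tau> Y snd \<^sub>v* B3mat M G \<tau>)
         - (1 / \<epsilon>) \<cdot>\<^sub>v (- (Lam2t M \<tau> Y fst \<^sub>v* Pimat M snd) + Lam2t M \<tau> Y snd \<^sub>v* Pimat M fst)
         - (1 / \<epsilon>) \<cdot>\<^sub>v (Lam3t M \<tau> g z Y fst \<^sub>v* B2mat M G \<tau> + Lam3t M \<tau> g z Y snd \<^sub>v* B3mat M G \<tau>)"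
    and "\<not> (R = 0\<^sub>v (nv M) \<and> V = 0\<^sub>v (nv M))"
  shows "descent_direction M \<tau> \<epsilon> L g z Y G U R V"
proof -
  note mesh = \<open>admissible_mesh M\<close>
  \<comment> \<open>For invertible \<open>Kmat M\<close>, \<open>q\<close> is the discrete adjoint
    state as a row vector. As the row product associates to the left, \<open>q\<close> is a common
    factor of the formulas for \<open>V\<close> and \<open>R\<close>.\<close>
  define q where "q = adj_row M \<tau> \<epsilon> L Y \<^sub>v* inv_mat (Kmat M)"
  define w1 where "w1 = Lam1t M \<tau> Y fst \<^sub>v* B2mat M G \<tau> + Lam1t M \<tau> Y snd \<^sub>v* B3mat M G \<tau>"
  define w2 where "w2 = - (Lam2t M \<tau> Y fst \<^sub>v* Pimat M snd) + Lam2t M \<tau> Y snd \<^sub>v* Pimat M fst"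
  define w3 where "w3 = Lam3t M \<tau> g z Y fst \<^sub>v* B2mat M G \<tau> + Lam3t M \<tau> g z Y snd \<^sub>v* B3mat M G \<tau>"
  have V_eq: "V = - (q \<^sub>v* B1mat M G \<epsilon>)"
    and R_eq: "R = - (q \<^sub>v* C1mat M G \<epsilon> U) - (1 / \<epsilon>) \<cdot>\<^sub>v w1 - (1 / \<epsilon>) \<cdot>\<^sub>v w2 - (1 / \<epsilon>) \<cdot>\<^sub>v w3"
    using assms(16,17) by (simp_all only: q_def w1_def w2_def w3_def)

  have mats: "B1mat M G \<epsilon> \<in> carrier_mat (n0 M) (nv M)" "C1mat M G \<epsilon> U \<in> carrier_mat (n0 M) (nv M)"
    "B2mat M G \<tau> \<in> carrier_mat (steps \<tau>) (nv M)" "B3mat M G \<tau> \<in> carrier_mat (steps \<tau>) (nv M)"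
    "Pimat M c \<in> carrier_mat (nv M) (nv M)" "Nmat M \<tau> \<in> carrier_mat (n0 M) (n0 M)"
    "MED M \<in> carrier_mat (nE M) (n0 M)" for c
    by (simp_all add: B1mat_def C1mat_def B2mat_def B3mat_def Pimat_def Nmat_def MED_def
        matrix_of_map_carrier)
  have Kinv: "inv_mat (Kmat M) \<in> carrier_mat (n0 M) (n0 M)"
    by (rule inv_mat_carrier) (simp add: Kmat_def)
  have lams: "Lam1t M \<tau> Y c \<in> carrier_vec (steps \<tau>)" "Lam2t M \<tau> Y c \<in> carrier_vec (nv M)"
    "Lam3t M \<tau> g z Y c \<in> carrier_vec (steps \<tau>)" for c
    by (simp_all add: Lam1t_def Lam2t_def Lam3t_def)
  \<comment> \<open>The length of a row product is read off from its matrix.\<close>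
  have adj: "adj_row M \<tau> \<epsilon> L Y \<in> carrier_vec (n0 M)"
    unfolding adj_row_def
    using row_mult_carrier[OF mats(6)] row_mult_carrier[OF mats(7)]
    by (metis add_carrier_vec smult_carrier_vec)
  have q: "q \<in> carrier_vec (n0 M)"
    unfolding q_def by (rule row_mult_carrier[OF Kinv])
  have qB: "q \<^sub>v* B1mat M G \<epsilon> \<in> carrier_vec (nv M)" and qC: "q \<^sub>v* C1mat M G \<epsilon> U \<in> carrier_vec (nv M)"
    using mats by auto
  have rows: "v \<^sub>v* B2mat M G \<tau> \<in> carrier_vec (nv M)" "v \<^sub>v* B3mat M G \<tau> \<in> carrier_vec (nv M)"
    "v \<^sub>v* Pimat M c \<in> carrier_vec (nv M)" for v c
    by (rule row_mult_carrier[OF mats(3)] row_mult_carrier[OF mats(4)] row_mult_carrier[OF mats(5)])+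
  have w: "w1 \<in> carrier_vec (nv M)" "w2 \<in> carrier_vec (nv M)" "w3 \<in> carrier_vec (nv M)"
    unfolding w1_def w2_def w3_def using rows by auto
  have V: "V \<in> carrier_vec (nv M)" and R: "R \<in> carrier_vec (nv M)"
    unfolding V_eq R_eq using qB qC w by auto

  \<comment> \<open>All matrices are moved to the left factor, leaving covectors paired with the
    bare \<open>V\<close> and \<open>R\<close>.\<close>
  have "adj_row M \<tau> \<epsilon> L Y \<bullet> (inv_mat (Kmat M) *\<^sub>v (B1mat M G \<epsilon> *\<^sub>v V + C1mat M G \<epsilon> U *\<^sub>v R)) =
      q \<bullet> (B1mat M G \<epsilon> *\<^sub>v V + C1mat M G \<epsilon> U *\<^sub>v R)"
    unfolding q_def
    by (rule row_mult_scalar_prod[OF Kinv adj, symmetric]) (use mats V R in auto)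
  also have "\<dots> = q \<bullet> (B1mat M G \<epsilon> *\<^sub>v V) + q \<bullet> (C1mat M G \<epsilon> U *\<^sub>v R)"
    by (rule scalar_prod_add_distrib[OF q]) (use mats V R in auto)
  also have "\<dots> = (q \<^sub>v* B1mat M G \<epsilon>) \<bullet> V + (q \<^sub>v* C1mat M G \<epsilon> U) \<bullet> R"
    by (simp add: row_mult_scalar_prod[OF mats(1) q V] row_mult_scalar_prod[OF mats(2) q R])
  finally have e0: "adj_row M \<tau> \<epsilon> L Y \<bullet>
      (inv_mat (Kmat M) *\<^sub>v (B1mat M G \<epsilon> *\<^sub>v V + C1mat M G \<epsilon> U *\<^sub>v R)) = \<dots>" .
  have e1: "Lam1t M \<tau> Y fst \<bullet> Wvec M G \<tau> fst R + Lam1t M \<tau> Y snd \<bullet> Wvec M G \<tau> snd R = w1 \<bullet> R"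
    unfolding w1_def
    by (simp add: add_scalar_prod_distrib[OF rows(1,2) R] row_mult_scalar_prod[OF mats(3) lams(1) R]
        row_mult_scalar_prod[OF mats(4) lams(1) R] B2mat_mult[OF mesh R] B3mat_mult[OF mesh R])
  \<comment> \<open>Here \<open>dJ\<close> already contains the matrices \<open>Pimat\<close>, so
    transposition suffices; \<open>e1\<close> and \<open>e3\<close> also replace the variations by
    matrix products.\<close>
  have e2: "- (Lam2t M \<tau> Y fst \<bullet> (Pimat M snd *\<^sub>v R)) + Lam2t M \<tau> Y snd \<bullet> (Pimat M fst *\<^sub>v R) = w2 \<bullet> R"
    unfolding w2_def
    using rows(3) R
    by (simp add: add_scalar_prod_distrib[of _ "nv M"] row_mult_scalar_prod[OF mats(5) lams(2) R])
  have e3: "Lam3t M \<tau> g z Y fst \<bullet> Wvec M G \<tau> fst R + Lam3t M \<tau> g z Y snd \<bullet> Wvec M G \<tau> snd R = w3 \<bullet> R"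
    unfolding w3_def
    by (simp add: add_scalar_prod_distrib[OF rows(1,2) R] row_mult_scalar_prod[OF mats(3) lams(3) R]
        row_mult_scalar_prod[OF mats(4) lams(3) R] B2mat_mult[OF mesh R] B3mat_mult[OF mesh R])

  \<comment> \<open>Only the left factor is expanded, so that the pairing with \<open>V\<close> on
    the right matches the one in \<open>e0\<close>; likewise for \<open>R\<close> below.\<close>
  have VV: "V \<bullet> V = - ((q \<^sub>v* B1mat M G \<epsilon>) \<bullet> V)"
    by (subst (1) V_eq) (use qB V in simp)
  have "R \<bullet> R = (- (q \<^sub>v* C1mat M G \<epsilon> U) - (1 / \<epsilon>) \<cdot>\<^sub>v w1 - (1 / \<epsilon>) \<cdot>\<^sub>v w2 - (1 / \<epsilon>) \<cdot>\<^sub>v w3) \<bullet> R"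
    by (subst (1) R_eq) (rule refl)
  also have "\<dots> = - ((q \<^sub>v* C1mat M G \<epsilon> U) \<bullet> R) - 1 / \<epsilon> * (w1 \<bullet> R) - 1 / \<epsilon> * (w2 \<bullet> R) - 1 / \<epsilon> * (w3 \<bullet> R)"
    using qC w R by (simp add: minus_scalar_prod_distrib[of _ "nv M"])
  finally have RR: "R \<bullet> R = \<dots>" .
  have "dJ M \<tau> \<epsilon> L g z Y G U R V = - (R \<bullet> R) - V \<bullet> V"
    unfolding dJ_def e0 e1 e2 e3 RR VV by simp
  \<comment> \<open>Strictness comes from excluding \<open>R\<close> and \<open>V\<close> both zero,
    where \<open>dJ\<close> would vanish: if \<open>R\<close> is zero, \<open>V\<close> is
    not.\<close>
  moreover have "0 < R \<bullet> R + V \<bullet> V"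
    using scalar_prod_self_pos[OF R] scalar_prod_self_pos[OF V] assms(18)
    by (cases "R = 0\<^sub>v (nv M)") auto
  ultimately show ?thesis
    unfolding descent_direction_def using R V by simp
qed

end
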